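(* Let $N$ and $\rho$ be integers with $1<\rho<N$, and let $q=(q')^{\rho+1}$ for any prime power $q'$. Then \[ s_q(N,\rho)\le\frac{(\rho+1)(\rho+2)}{2}(q')^{N-\rho}+\rho(\rho+1)\frac{(q')^{N-\rho}-1}{q'-1}. \]
   Context: A point $P$ of $\mathrm{PG}(N,q)$ is $\rho$-saturated by a point set $\mathcal{S}$ if there exists a subspace through $P$ of dimension at most $\rho$ spanned by points of $\mathcal{S}$. A point set $\mathcal{S}$ is a $\rho$-saturating set of $\mathrm{PG}(N,q)$ if $\rho$ is the least integer such that all points of $\mathrm{PG}(N,q)$ are $\rho$-saturated by $\mathcal{S}$. $s_q(N,\rho)$ denotes the minimum size of a $\rho$-saturating set of $\mathrm{PG}(N,q)$. *)

theory Defs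
  imports "HOL-Analysis.Cartesian_Space" "HOL-Number_Theory.Prime_Powers"
begin

text \<open>
  The projective space \<open>PG(N, q)\<close> is modelled on the vector space \<^typ>\<open>'a ^ 'n\<close>, where \<open>'a\<close> is a
  field with \<open>q\<close> elements and \<open>CARD('n) = N + 1\<close>. A projective subspace is given by the
  corresponding linear subspace, whose linear dimension is the projective dimension plus one;
  points are the linear subspaces of linear dimension one.
\<close>

definition pg_points :: "('a::field ^ 'n) set set" where
  "pg_points = {P. vec.subspace P \<and> vec.dim P = 1}"

definition pg_span :: "('a::field ^ 'n) set set \<Rightarrow> ('a ^ 'n) set" where
  "pg_span T = vec.span (\<Union>T)"

definition saturated_point :: "nat \<Rightarrow> ('a::field ^ 'n) set set \<Rightarrow> ('a ^ 'n) set \<Rightarrow> bool" where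
  "saturated_point \<rho> S P \<longleftrightarrow>
     (\<exists>T. T \<subseteq> S \<and> P \<subseteq> pg_span T \<and> vec.dim (pg_span T) \<le> \<rho> + 1)"

text \<open>
  No point is saturated for a negative parameter (a subspace through a point has projective
  dimension at least 0), so the least integer is the least natural number.
\<close>

definition saturating_set :: "nat \<Rightarrow> ('a::field ^ 'n) set set \<Rightarrow> bool" where
  "saturating_set \<rho> S \<longleftrightarrow>
     S \<subseteq> pg_points \<and>
     (\<forall>P\<in>pg_points. saturated_point \<rho> S P) \<and>
     (\<forall>\<sigma><\<rho>. \<not> (\<forall>P\<in>pg_points. saturated_point \<sigma> S P))"

text \<open>
  \<^const>\<open>Min\<close> is unspecified on the empty set, so a bound on this number can only be proved together
  with the existence of a saturating set.
\<close>

definition min_saturating_size :: "('a::{field,finite} ^ 'n) itself \<Rightarrow> nat \<Rightarrow> nat" where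
  "min_saturating_size _ \<rho> = Min {card S |S :: ('a ^ 'n) set set. saturating_set \<rho> S}"

end

theory Submission
  imports Defs "HOL-Number_Theory.Residues" "HOL-Computational_Algebra.Polynomial"
begin

text \<open>
  Let \<open>K\<close> be the subfield of order \<open>q'\<close>, \<open>k = \<rho> + 1\<close>, and let \<open>b\<^sub>1, \<dots>, b\<^sub>k\<close> be a \<open>K\<close>-basis of the
  whole field. Write vectors as \<open>(x, y)\<close> with \<open>k\<close> coordinates in \<open>x\<close> and \<open>N - \<rho>\<close> in \<open>y\<close>, and take the points
  \<open>(e\<^sub>i, b\<^sub>j u)\<close> for \<open>j \<le> i\<close> and the points \<open>(0, u)\<close>, where \<open>u\<close> has coordinates in \<open>K\<close>. Given \<open>(x, y)\<close>, choose
  successively \<open>c\<^sub>i = x\<^sub>i b\<^sub>j\<close> with \<open>j \<le> i\<close> outside the \<open>K\<close>-span of \<open>c\<^sub>1, \<dots>, c\<^sub>i\<^sub>-\<^sub>1\<close> (an arbitrary \<open>c\<^sub>i\<close> outside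
  that span if \<open>x\<^sub>i = 0\<close>): the \<open>i\<close> elements \<open>x\<^sub>i b\<^sub>j\<close> are independent, so they do not all lie in it. Then
  \<open>c\<^sub>1, \<dots>, c\<^sub>k\<close> is a \<open>K\<close>-basis, so \<open>y = c\<^sub>1 u\<^sub>1 + \<dots> + c\<^sub>k u\<^sub>k\<close>, which exhibits \<open>(x, y)\<close> as a combination of
  \<open>k\<close> of the points. This set may saturate with a smaller parameter than \<open>\<rho>\<close>; it contains the coordinate
  points, and projecting from these one after the other reaches the parameter \<open>\<rho>\<close> exactly.
\<close>

section \<open>Subfields of finite fields\<close>

text \<open>Multiplication by \<open>x\<close> permutes the nonzero elements, so extracting the
  factor \<open>x\<close> from each leaves their product unchanged.\<close>

lemma power_card_minus_one_eq_one:
  fixes x :: "'a::{field,finite}"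
  assumes "x \<noteq> 0"
  shows "x ^ (CARD('a) - 1) = 1"
proof -
  have "(\<Prod>y\<in>UNIV - {0}. x * y) = \<Prod>(UNIV - {0})"
    by (rule prod.reindex_bij_witness[of _ "\<lambda>y. y / x" "\<lambda>y. x * y"]) (use assms in auto)
  then have "x ^ (CARD('a) - 1) * \<Prod>(UNIV - {0::'a}) = 1 * \<Prod>(UNIV - {0})"
    by (simp add: prod.distrib card_Diff_singleton)
  moreover have "\<Prod>(UNIV - {0::'a}) \<noteq> 0"
    by simp
  ultimately show ?thesis
    by (metis mult_right_cancel)
qed

text \<open>Every nonzero element is a root of X^(de) - 1 = (X^d - 1) * p with p = 1 + X^d + ... +
  X^(d(e-1)). As p accounts for at most d(e-1) of the de nonzero elements, X^d - 1 has at least d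
  roots, and it cannot have more.\<close>

lemma card_roots_of_unity_finite_field:
  assumes "CARD('a::{field,finite}) - 1 = d * e" and "CARD('a) > 1"
  shows "card {x::'a. x ^ d = 1} = d"
proof -
  have de: "d > 0" "e > 0"
    using assms by (auto intro!: Nat.gr0I)
  define p :: "'a poly" where "p = (\<Sum>i<e. monom 1 (d * i))"
  have "coeff p 0 = (\<Sum>i<e. if i = 0 then 1 else 0)"
    unfolding p_def coeff_sum using de by (intro sum.cong) auto
  then have "coeff p 0 = 1"
    using de by simp
  then have "p \<noteq> 0"
    by auto
  have "degree p \<le> d * (e - 1)"
    unfolding p_def
    by (intro degree_sum_le order.trans[OF degree_monom_le]) auto
  with \<open>p \<noteq> 0\<close> have p_roots: "card {x. poly p x = 0} \<le> d * (e - 1)"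
    using card_poly_roots_bound order.trans by blast
  have cover: "UNIV - {0} \<subseteq> {x::'a. x ^ d = 1} \<union> {x. poly p x = 0}"
  proof safe
    fix x :: 'a
    assume x: "x \<noteq> 0" "poly p x \<noteq> 0"
    have "(x ^ d) ^ e = 1"
      using power_card_minus_one_eq_one[OF x(1)] assms by (simp add: power_mult)
    then have "(1 - x ^ d) * (\<Sum>i<e. (x ^ d) ^ i) = 0"
      by (simp flip: one_diff_power_eq)
    moreover have "poly p x = (\<Sum>i<e. (x ^ d) ^ i)"
      by (simp add: p_def poly_sum poly_monom power_mult)
    ultimately show "x ^ d = 1"
      using x by auto
  qed
  have "d * e = card (UNIV - {0::'a})"
    using assms by (simp add: card_Diff_singleton)
  also have "\<dots> \<le> card {x::'a. x ^ d = 1} + card {x. poly p x = 0}"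
    using card_mono[OF _ cover] card_Un_le order.trans by fastforce
  finally have "d * e \<le> card {x::'a. x ^ d = 1} + d * (e - 1)"
    using p_roots by linarith
  moreover have "d * e = d + d * (e - 1)"
    using de by (cases e) auto
  ultimately have "d \<le> card {x::'a. x ^ d = 1}"
    by linarith
  moreover have "card {x::'a. x ^ d = 1} \<le> d"
  proof -
    have "degree (monom (1::'a) d - 1) \<le> d"
      by (intro degree_diff_le) (auto simp: degree_monom_le)
    moreover have "coeff (monom (1::'a) d - 1) d = 1"
      using de by simp
    then have "monom (1::'a) d - 1 \<noteq> 0"
      by (metis coeff_0 zero_neq_one)
    ultimately have "card {x. poly (monom (1::'a) d - 1) x = 0} \<le> d"
      using card_poly_roots_bound order.trans by blast
    then show ?thesis
      by (simp add: poly_monom)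
  qed
  ultimately show ?thesis
    by linarith
qed

locale finite_subfield =
  fixes K :: "'a::{field,finite} set"
  assumes zero_mem: "0 \<in> K" and one_mem: "1 \<in> K"
    and diff_mem: "\<And>x y. x \<in> K \<Longrightarrow> y \<in> K \<Longrightarrow> x - y \<in> K"
    and mult_mem: "\<And>x y. x \<in> K \<Longrightarrow> y \<in> K \<Longrightarrow> x * y \<in> K"
    and inverse_mem: "\<And>x. x \<in> K \<Longrightarrow> inverse x \<in> K"

text \<open>The subfield is the fixed set of the Frobenius power x -> x^r. Its nonzero elements are
  the roots of unity of order dividing r - 1, and r - 1 divides r^n - 1, so there are exactly r - 1
  of them.\<close>

lemma finite_subfield_exists:
  assumes "primepow r" and "CARD('a::{field,finite}) = r ^ n" and "n > 0"
  obtains K :: "'a::{field,finite} set" where "finite_subfield K" and "card K = r"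
proof -
  obtain p s where ps: "prime p" "s > 0" "r = p ^ s"
    using assms(1) by (auto simp: primepow_def)
  have "prime CHAR('a)"
    using prime_CHAR_semidom finite_imp_CHAR_pos[where 'a='a] by auto
  moreover have "CHAR('a) dvd p ^ (s * n)"
    using CHAR_dvd_CARD[where 'a='a] assms ps by (simp add: power_mult)
  ultimately have char: "CHAR('a) = p"
    using ps by (metis prime_dvd_power primes_dvd_imp_eq)
  have "r > 1"
    using assms(1) primepow_gt_Suc_0 by auto
  define K :: "'a set" where "K = {x. x ^ r = x}"
  have add: "(x + y) ^ r = x ^ r + y ^ r" for x y :: 'a
    using freshmans_dream'[where 'a='a] \<open>prime CHAR('a)\<close> char ps by metis
  have "finite_subfield K"
  proof
    fix x y assume "x \<in> K" "y \<in> K"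
    then show "x - y \<in> K"
      \<comment> \<open>Additivity is applied to x = (x - y) + y, which avoids a sign discussion for
        (-y)^r.\<close>
      using add[of "x - y" y] by (simp add: K_def) (metis add_diff_cancel_right')
  qed (use \<open>r > 1\<close> in \<open>auto simp: K_def power_mult_distrib power_inverse\<close>)
  moreover have "card K = r"
  proof -
    have "r - 1 dvd r ^ n - 1"
    proof -
      have "int r - 1 dvd int r ^ n - 1"
        using power_diff_1_eq by (metis dvd_triv_left)
      moreover have "int r - 1 = int (r - 1)" "int r ^ n - 1 = int (r ^ n - 1)"
        using \<open>r > 1\<close> by (simp_all add: of_nat_diff)
      ultimately show ?thesis
        by (simp only: int_dvd_int_iff)
    qed
    then obtain e where "r ^ n - 1 = (r - 1) * e"
      by blast
    moreover have "r ^ n > 1"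
      using one_less_power[OF \<open>r > 1\<close> assms(3)] .
    ultimately have "card {x::'a. x ^ (r - 1) = 1} = r - 1"
      using card_roots_of_unity_finite_field[where 'a='a, of "r - 1" e] assms(2) by simp
    moreover have "K = insert 0 {x. x ^ (r - 1) = 1}"
    proof -
      have "x ^ r = x * x ^ (r - 1)" for x :: 'a
        using \<open>r > 1\<close> power_eq_if[of x r] by simp
      then show ?thesis
        by (auto simp: K_def)
    qed
    moreover have "(0::'a) \<notin> {x. x ^ (r - 1) = 1}"
      using \<open>r > 1\<close> by (simp add: power_0_left)
    ultimately have "card K = Suc (r - 1)"
      by (metis card_insert_disjoint finite)
    then show ?thesis
      using \<open>r > 1\<close> by simp
  qed
  ultimately show ?thesis
    using that by blast
qed

section \<open>Linear algebra over the subfield for sequences of field elements\<close>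

context finite_subfield
begin

definition comb :: "(nat \<Rightarrow> 'a) \<Rightarrow> nat \<Rightarrow> 'a set" where
  "comb c t = {\<Sum>i<t. a i * c i | a. \<forall>i. a i \<in> K}"

text \<open>Linear independence over \<open>K\<close>, phrased by comparing each element only with
  earlier ones: this form passes to initial segments and suits a choice one element at a
  time.\<close>

definition indep :: "(nat \<Rightarrow> 'a) \<Rightarrow> nat \<Rightarrow> bool" where
  "indep c t \<longleftrightarrow> (\<forall>i<t. c i \<notin> comb c i)"

lemma comb_cong: "(\<And>i. i < t \<Longrightarrow> c i = d i) \<Longrightarrow> comb c t = comb d t"
proof -
  assume "\<And>i. i < t \<Longrightarrow> c i = d i"
  then have "(\<Sum>i<t. a i * c i) = (\<Sum>i<t. a i * d i)" for a
    by (intro sum.cong) auto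
  then show ?thesis
    by (simp add: comb_def)
qed

lemma comb_diff: "x \<in> comb c t \<Longrightarrow> y \<in> comb c t \<Longrightarrow> x - y \<in> comb c t"
proof -
  assume "x \<in> comb c t" "y \<in> comb c t"
  then obtain a b where "\<forall>i. a i \<in> K" "\<forall>i. b i \<in> K"
    and "x = (\<Sum>i<t. a i * c i)" "y = (\<Sum>i<t. b i * c i)"
    by (auto simp: comb_def)
  then show ?thesis
    unfolding comb_def
    by (intro CollectI exI[of _ "\<lambda>i. a i - b i"]) (auto simp: diff_mem left_diff_distrib sum_subtractf)
qed

lemma comb_scale: "r \<in> K \<Longrightarrow> x \<in> comb c t \<Longrightarrow> r * x \<in> comb c t"
proof -
  assume r: "r \<in> K" and "x \<in> comb c t"
  then obtain a where "\<forall>i. a i \<in> K" "x = (\<Sum>i<t. a i * c i)"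
    by (auto simp: comb_def)
  with r show ?thesis
    unfolding comb_def
    by (intro CollectI exI[of _ "\<lambda>i. r * a i"]) (auto simp: mult_mem sum_distrib_left mult.assoc)
qed

lemma comb_Suc: "comb c (Suc t) = (\<lambda>(w, a). w + a * c t) ` (comb c t \<times> K)"
proof
  show "comb c (Suc t) \<subseteq> (\<lambda>(w, a). w + a * c t) ` (comb c t \<times> K)"
    by (auto simp: comb_def image_iff)
  show "(\<lambda>(w, a). w + a * c t) ` (comb c t \<times> K) \<subseteq> comb c (Suc t)"
  proof clarify
    fix w b assume "w \<in> comb c t" and b: "b \<in> K"
    then obtain a where a: "\<forall>i. a i \<in> K" "w = (\<Sum>i<t. a i * c i)"
      by (auto simp: comb_def)
    then have "w + b * c t = (\<Sum>i<Suc t. (a(t := b)) i * c i)"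
      by simp
    with a b show "w + b * c t \<in> comb c (Suc t)"
      unfolding comb_def by (intro CollectI exI[of _ "a(t := b)"]) auto
  qed
qed

text \<open>Each new element multiplies the size by \<open>card K\<close>: two representations
  \<open>w + a * c t\<close> with different \<open>a\<close> could be solved for \<open>c t\<close>,
  putting it in the span of its predecessors.\<close>

lemma card_comb: "indep c t \<Longrightarrow> card (comb c t) = card K ^ t"
proof (induction t)
  case 0
  have "comb c 0 = {0}"
    using zero_mem by (auto simp: comb_def)
  then show ?case
    by simp
next
  case (Suc t)
  have "inj_on (\<lambda>(w, a). w + a * c t) (comb c t \<times> K)"
  proof (rule inj_onI, clarify)
    fix w a w' a'
    assume w: "w \<in> comb c t" "w' \<in> comb c t" and a: "a \<in> K" "a' \<in> K"
      and eq: "w + a * c t = w' + a' * c t"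
    have "a = a'"
    proof (rule ccontr)
      assume "a \<noteq> a'"
      then have "c t = inverse (a - a') * (w' - w)"
        using eq by (simp add: field_simps)
      then have "c t \<in> comb c t"
        using w a by (metis comb_diff comb_scale diff_mem inverse_mem)
      then show False
        using Suc.prems by (auto simp: indep_def)
    qed
    with eq show "w = w' \<and> a = a'"
      by simp
  qed
  then show ?case
    using Suc by (simp add: comb_Suc card_image card_cartesian_product indep_def)
qed

text \<open>The elements are chosen in order. The hypothesis ranges over all independent prefixes
  because the earlier choices are not known in advance.\<close>

lemma indep_greedy:
  assumes "\<And>i c. i < t \<Longrightarrow> indep c i \<Longrightarrow> \<exists>x. Q i x \<and> x \<notin> comb c i"
  shows "\<exists>c. indep c t \<and> (\<forall>i<t. Q i (c i))"
  using assms
proof (induction t)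
  case 0
  then show ?case
    by (simp add: indep_def)
next
  case (Suc t)
  then obtain c where c: "indep c t" "\<forall>i<t. Q i (c i)"
    by (meson less_SucI)
  with Suc.prems obtain x where x: "Q t x" "x \<notin> comb c t"
    by blast
  \<comment> \<open>The span of the first \<open>i\<close> elements does not see position
    \<open>t\<close>, so the earlier choices remain valid.\<close>
  have "comb (c(t := x)) i = comb c i" if "i \<le> t" for i
    using that by (intro comb_cong) auto
  then have "indep (c(t := x)) (Suc t)"
    using c x by (simp add: indep_def less_Suc_eq)
  moreover have "\<forall>i<Suc t. Q i ((c(t := x)) i)"
    using c x by (simp add: less_Suc_eq)
  ultimately show ?case
    by blast
qed

text \<open>Fewer than \<open>k\<close> independent elements span too few elements to exhaust the
  field, so the sequence can be extended until it is a basis.\<close>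

lemma exists_indep:
  assumes "CARD('a) = card K ^ k"
  shows "\<exists>b. indep b k"
proof -
  have "\<exists>x. True \<and> x \<notin> comb c i" if "i < k" "indep c i" for i c
  proof -
    have "card K > 1"
      using zero_mem one_mem by (metis card_le_Suc0_iff_eq finite linorder_not_less zero_neq_one One_nat_def)
    then have "card (comb c i) < CARD('a)"
      using that assms by (simp add: card_comb)
    then show ?thesis
      by (metis UNIV_eq_I less_irrefl)
  qed
  from indep_greedy[where Q="\<lambda>_ _. True", OF this] show ?thesis
    by blast
qed

text \<open>The counting step: \<open>x\<close> times the span of \<open>b 0, \<dots>, b i\<close> is too large to fit into the span
  of only \<open>i\<close> elements.\<close>

lemma exists_multiple_notin_comb:
  assumes "indep b (Suc i)" and "indep c i" and "x \<noteq> 0"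
  shows "\<exists>j\<le>i. x * b j \<notin> comb c i"
proof (rule ccontr)
  assume "\<not> ?thesis"
  then have mem: "x * b j \<in> comb c i" if "j < Suc i" for j
    using that by auto
  have zero: "0 \<in> comb c i"
    unfolding comb_def using zero_mem by (intro CollectI exI[of _ "\<lambda>_. 0"]) auto
  have add: "y + z \<in> comb c i" if "y \<in> comb c i" "z \<in> comb c i" for y z
    using comb_diff[OF that(1) comb_diff[OF zero that(2)]] by simp
  have "x * y \<in> comb c i" if "y \<in> comb b t" "t \<le> Suc i" for y t
    using that
  proof (induction t arbitrary: y)
    case 0
    then show ?case
      using zero by (auto simp: comb_def)
  next
    case (Suc t)
    then obtain w a where wa: "w \<in> comb b t" "a \<in> K" "y = w + a * b t"
      by (auto simp: comb_Suc)
    then have "x * y = x * w + a * (x * b t)"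
      by (simp add: algebra_simps)
    moreover have "x * w \<in> comb c i"
      using Suc wa by simp
    moreover have "a * (x * b t) \<in> comb c i"
      using Suc.prems wa by (intro comb_scale mem) auto
    ultimately show ?case
      using add by simp
  qed
  then have "(*) x ` comb b (Suc i) \<subseteq> comb c i"
    by auto
  then have "card (comb b (Suc i)) \<le> card (comb c i)"
    using assms(3) by (intro card_inj_on_le[of "(*) x"]) (auto simp: inj_on_def)
  then have "card K ^ Suc i \<le> card K ^ i"
    using assms by (simp only: card_comb)
  moreover have "card K > 1"
    using zero_mem one_mem by (metis card_le_Suc0_iff_eq finite linorder_not_less zero_neq_one One_nat_def)
  ultimately show False
    by simp
qed

end

section \<open>Attaining the saturation parameter exactly\<close>

lemma span_singleton_in_pg_points: "v \<noteq> 0 \<Longrightarrow> vec.span {v} \<in> pg_points"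
  by (simp add: pg_points_def vec.subspace_span)

lemma pg_pointsE:
  assumes "P \<in> pg_points"
  obtains v where "v \<noteq> 0" and "P = vec.span {v}"
proof -
  from assms have P: "vec.subspace P" "vec.dim P = 1"
    by (auto simp: pg_points_def)
  obtain B where B: "B \<subseteq> P" "vec.independent B" "P \<subseteq> vec.span B" "card B = vec.dim P"
    using vec.basis_exists by blast
  then obtain v where v: "B = {v}"
    using P by (metis card_1_singletonE)
  have "v \<noteq> 0"
    using B v vec.dependent_zero by blast
  moreover have "P = vec.span {v}"
    using B v P by (metis vec.span_minimal subset_antisym)
  ultimately show ?thesis
    using that by blast
qed

lemma saturated_point_mono:
  "saturated_point \<sigma> S P \<Longrightarrow> \<sigma> \<le> \<rho> \<Longrightarrow> saturated_point \<rho> S P"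
  unfolding saturated_point_def by (meson add_le_mono1 order.trans)

section \<open>Projection from a coordinate point\<close>

definition axis_point :: "'n \<Rightarrow> ('a::field ^ 'n::finite) set" where
  "axis_point i = vec.span {axis i 1}"

text \<open>The projection from coordinate point \<open>i\<close> onto the hyperplane where
  coordinate \<open>i\<close> vanishes, kept inside the same ambient space so that it can be
  iterated without changing the type.\<close>

definition drop_coord :: "'n \<Rightarrow> 'a::field ^ 'n \<Rightarrow> 'a ^ 'n::finite" where
  "drop_coord i v = (\<chi> j. if j = i then 0 else v $ j)"

lemma linear_drop_coord: "Vector_Spaces.linear (*s) (*s) (drop_coord i)"
  by unfold_locales (auto simp: drop_coord_def vec_eq_iff)

lemma drop_coord_axis: "drop_coord i (axis j 1) = (if j = i then 0 else axis j 1)"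
  by (auto simp: drop_coord_def axis_def vec_eq_iff)

lemma drop_coord_image_span: "drop_coord i ` vec.span B = vec.span (drop_coord i ` B)"
  by (rule vec.linear_span_image[OF linear_drop_coord, symmetric])

lemma drop_coord_image_axis_point:
  "drop_coord i ` axis_point j = (if j = i then {0} else axis_point j)"
  by (simp add: axis_point_def drop_coord_image_span drop_coord_axis)

lemma axis_nonzero: "axis i (1::'a::field) \<noteq> (0 :: 'a ^ 'n::finite)"
  by (simp add: axis_eq_0_iff)

lemma axis_point_in_pg_points: "axis_point i \<in> pg_points"
  unfolding axis_point_def by (intro span_singleton_in_pg_points axis_nonzero)

text \<open>The centre of the projection is sent to \<open>{0}\<close>, which is not a point; it is
  removed from the image and the centre itself is put back.\<close>

definition split_off :: "'n \<Rightarrow> ('a::field ^ 'n::finite) set set \<Rightarrow> ('a ^ 'n) set set" where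
  "split_off i S = insert (axis_point i) ((`) (drop_coord i) ` S - {{0}})"

lemma split_off_subset_pg_points:
  assumes "S \<subseteq> pg_points"
  shows "split_off i S \<subseteq> pg_points"
proof
  fix Q assume Q: "Q \<in> split_off i S"
  show "Q \<in> pg_points"
  proof (cases "Q = axis_point i")
    case False
    with Q obtain P where P: "P \<in> S" "Q = drop_coord i ` P" "Q \<noteq> {0}"
      by (auto simp: split_off_def)
    then obtain v where "P = vec.span {v}"
      using assms pg_pointsE by blast
    with P have "Q = vec.span {drop_coord i v}"
      by (simp add: drop_coord_image_span)
    with P show ?thesis
      using span_singleton_in_pg_points by (metis vec.span_insert_0 vec.span_empty)
  qed (simp add: axis_point_in_pg_points)
qed

lemma axis_point_nonzero: "axis_point i \<noteq> ({0} :: ('a::field ^ 'n::finite) set)"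
  using axis_point_in_pg_points[of i, where 'a='a] by (auto simp: pg_points_def)

lemma axis_points_subset_split_off:
  assumes "range axis_point \<subseteq> S"
  shows "range axis_point \<subseteq> split_off i S"
proof clarify
  fix j
  show "axis_point j \<in> split_off i S"
  proof (cases "j = i")
    case False
    then have "axis_point j = drop_coord i ` axis_point j"
      by (simp add: drop_coord_image_axis_point)
    with assms show ?thesis
      unfolding split_off_def using axis_point_nonzero by blast
  qed (simp add: split_off_def)
qed

text \<open>The centre belongs to \<open>S\<close> and vanishes under the projection, which pays for
  putting it back; the other points can only merge or vanish.\<close>

lemma card_split_off_le:
  fixes S :: "('a::{field,finite} ^ 'n::finite) set set"
  assumes "range axis_point \<subseteq> S"
  shows "card (split_off i S) \<le> card S"
proof -
  have "split_off i S \<subseteq> insert (axis_point i) ((`) (drop_coord i) ` (S - {axis_point i}))"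
  proof
    fix Q assume Q: "Q \<in> split_off i S"
    show "Q \<in> insert (axis_point i) ((`) (drop_coord i) ` (S - {axis_point i}))"
    proof (cases "Q = axis_point i")
      case False
      with Q obtain P where P: "P \<in> S" "Q = drop_coord i ` P" "Q \<noteq> {0}"
        by (auto simp: split_off_def)
      then have "P \<noteq> axis_point i"
        using drop_coord_image_axis_point[of i i] by auto
      with P show ?thesis
        by blast
    qed simp
  qed
  then have "card (split_off i S) \<le> card (insert (axis_point i) ((`) (drop_coord i) ` (S - {axis_point i})))"
    by (intro card_mono) auto
  also have "\<dots> \<le> Suc (card ((`) (drop_coord i) ` (S - {axis_point i})))"
    by (rule card_insert_le_m1) auto
  also have "\<dots> \<le> Suc (card (S - {axis_point i}))"
    by (simp add: card_image_le)
  also have "\<dots> = card S"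
    using assms by (intro card_Suc_Diff1) auto
  finally show ?thesis .
qed

text \<open>A projected subspace together with the centre contains the original subspace, since a
  vector differs from its projection by a multiple of the axis vector. Its dimension exceeds the
  original by at most one.\<close>

lemma saturated_point_split_off:
  assumes "saturated_point \<sigma> S P"
  shows "saturated_point (Suc \<sigma>) (split_off i S) P"
proof -
  obtain T where T: "T \<subseteq> S" "P \<subseteq> pg_span T" "vec.dim (pg_span T) \<le> \<sigma> + 1"
    using assms by (auto simp: saturated_point_def)
  define T' where "T' = insert (axis_point i) ((`) (drop_coord i) ` T - {{0}})"
  have "\<Union>T' \<subseteq> vec.span (insert (axis i 1) (drop_coord i ` \<Union>T))"
  proof -
    have "axis_point i \<subseteq> vec.span (insert (axis i 1) (drop_coord i ` \<Union>T))"
      unfolding axis_point_def by (intro vec.span_mono) auto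
    moreover have "\<Union>((`) (drop_coord i) ` T - {{0}}) \<subseteq> vec.span (insert (axis i 1) (drop_coord i ` \<Union>T))"
      by (auto intro!: vec.span_base)
    ultimately show ?thesis
      by (auto simp: T'_def)
  qed
  then have "pg_span T' \<subseteq> vec.span (insert (axis i 1) (drop_coord i ` \<Union>T))"
    unfolding pg_span_def by (intro vec.span_minimal) auto
  then have "vec.dim (pg_span T') \<le> vec.dim (insert (axis i 1) (drop_coord i ` \<Union>T))"
    by (metis vec.dim_span vec.dim_subset)
  also have "\<dots> \<le> Suc (vec.dim (drop_coord i ` \<Union>T))"
    by (simp add: vec.dim_insert)
  also have "\<dots> \<le> Suc (vec.dim (\<Union>T))"
    using vec.dim_image_le[OF linear_drop_coord] by auto
  also have "\<dots> \<le> Suc \<sigma> + 1"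
    using T by (simp add: pg_span_def)
  finally have dim: "vec.dim (pg_span T') \<le> Suc \<sigma> + 1" .
  have "v \<in> pg_span T'" if "v \<in> P" for v
  proof -
    have "drop_coord i v \<in> vec.span (drop_coord i ` \<Union>T)"
      using T that by (auto simp: pg_span_def simp flip: drop_coord_image_span)
    moreover have "drop_coord i ` \<Union>T \<subseteq> pg_span T'"
    proof clarify
      fix w P assume wP: "w \<in> P" "P \<in> T"
      show "drop_coord i w \<in> pg_span T'"
      \<comment> \<open>A point sent to \<open>{0}\<close> is missing from \<open>T'\<close>, but
        contributes only the zero vector.\<close>
      proof (cases "drop_coord i ` P = {0}")
        case True
        with wP have "drop_coord i w = 0"
          by auto
        then show ?thesis
          by (simp add: pg_span_def vec.span_zero)
      next
        case False
        with wP have "drop_coord i ` P \<in> T'"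
          unfolding T'_def by blast
        with wP have "drop_coord i w \<in> \<Union>T'"
          by blast
        then show ?thesis
          by (simp add: pg_span_def vec.span_base)
      qed
    qed
    ultimately have "drop_coord i v \<in> pg_span T'"
      unfolding pg_span_def by (meson subsetD vec.span_minimal vec.subspace_span)
    moreover have "v $ i *s axis i 1 \<in> pg_span T'"
      unfolding pg_span_def T'_def axis_point_def
      by (intro vec.span_scale vec.span_base) (auto intro: vec.span_base)
    moreover have "v = drop_coord i v + v $ i *s axis i 1"
      by (auto simp: drop_coord_def axis_def vec_eq_iff)
    ultimately show ?thesis
      unfolding pg_span_def by (metis vec.span_add)
  qed
  moreover have "T' \<subseteq> split_off i S"
    using T by (auto simp: T'_def split_off_def)
  ultimately show ?thesis
    unfolding saturated_point_def using dim by blast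
qed

text \<open>The all-ones vector lies in no coordinate hyperplane, so every coordinate point is
  needed to span it, and together they span the whole space.\<close>

lemma axis_points_not_saturating:
  fixes S :: "('a::field ^ 'n::finite) set set"
  assumes "S \<subseteq> range axis_point" and "\<sigma> + 1 < CARD('n)"
  shows "\<exists>P\<in>pg_points. \<not> saturated_point \<sigma> S P"
proof -
  define v :: "'a ^ 'n" where "v = (\<chi> j. 1)"
  have "v \<noteq> 0"
    by (auto simp: v_def vec_eq_iff)
  moreover have "\<not> saturated_point \<sigma> S (vec.span {v})"
  proof
    assume "saturated_point \<sigma> S (vec.span {v})"
    then obtain T where T: "T \<subseteq> S" "v \<in> pg_span T" "vec.dim (pg_span T) \<le> \<sigma> + 1"
      unfolding saturated_point_def by (meson singletonI subsetD vec.span_base)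
    have "axis_point i \<in> T" for i
    proof (rule ccontr)
      assume "axis_point i \<notin> T"
      have "vec.subspace {w :: 'a ^ 'n. w $ i = 0}"
        by (auto simp: vec.subspace_def)
      moreover have "\<Union>T \<subseteq> {w. w $ i = 0}"
      proof (rule Union_least)
        fix P assume "P \<in> T"
        with T assms \<open>axis_point i \<notin> T\<close> obtain j where j: "P = axis_point j" "j \<noteq> i"
          by blast
        show "P \<subseteq> {w. w $ i = 0}"
          using j by (auto simp: axis_point_def vec.span_singleton axis_def)
      qed
      ultimately have "pg_span T \<subseteq> {w. w $ i = 0}"
        unfolding pg_span_def by (intro vec.span_minimal)
      with T show False
        by (auto simp: v_def)
    qed
    then have "axis i 1 \<in> pg_span T" for i
      unfolding pg_span_def by (intro vec.span_base) (metis UnionI axis_point_def insertI1 vec.span_base)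
    then have "cart_basis \<subseteq> pg_span T"
      by (auto simp: cart_basis_def)
    then have "vec.span cart_basis \<subseteq> pg_span T"
      unfolding pg_span_def by (intro vec.span_minimal) auto
    then have "pg_span T = UNIV"
      by (simp add: span_cart_basis top.extremum_unique)
    then have "vec.dim (pg_span T) = CARD('n)"
      by (simp add: card_cart_basis)
    with T assms show False
      by simp
  qed
  ultimately show ?thesis
    using span_singleton_in_pg_points by blast
qed

text \<open>Splitting off the coordinates one at a time ends in a set of parameter \<open>CARD('n) - 1\<close>, while
  every step raises the parameter by at most one; hence every intermediate value is attained.\<close>

lemma exists_saturating_set_card_le:
  fixes S :: "('a::{field,finite} ^ 'n::finite) set set"
  assumes "S \<subseteq> pg_points" and "range axis_point \<subseteq> S"
    and "\<forall>P\<in>pg_points. saturated_point \<rho> S P" and "\<rho> < CARD('n)"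
  shows "\<exists>S' :: ('a ^ 'n) set set. saturating_set \<rho> S' \<and> card S' \<le> card S"
proof -
  \<comment> \<open>\<open>J\<close> collects the coordinates already split off; for these, every
    point other than the coordinate point itself lies in the coordinate hyperplane. The induction is
    on the number of remaining coordinates.\<close>
  have "\<exists>S' :: ('a ^ 'n) set set. saturating_set \<rho> S' \<and> card S' \<le> card S"
    if "S \<subseteq> pg_points" "range axis_point \<subseteq> S" "\<forall>P\<in>pg_points. saturated_point \<rho> S P"
      and "\<forall>i\<in>J. \<forall>P\<in>S. P = axis_point i \<or> P \<subseteq> {v. v $ i = 0}"
    for S :: "('a ^ 'n) set set" and J
    using that
  proof (induction "card (- J)" arbitrary: J S rule: less_induct)
    case less
    show ?case
    proof (cases "saturating_set \<rho> S")
      case False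
      \<comment> \<open>A smaller parameter leaves room for one more projection:
        \<open>Suc \<sigma> \<le> \<rho>\<close>.\<close>
      with less.prems obtain \<sigma> where \<sigma>: "\<sigma> < \<rho>" "\<forall>P\<in>pg_points. saturated_point \<sigma> S P"
        by (auto simp: saturating_set_def)
      \<comment> \<open>Once all coordinates are split off, only coordinate points remain, and these
        do not saturate with parameter \<open>\<sigma>\<close>.\<close>
      have "J \<noteq> UNIV"
      proof
        assume "J = UNIV"
        have "S \<subseteq> range axis_point"
        proof (rule ccontr)
          assume "\<not> ?thesis"
          then obtain P where P: "P \<in> S" "P \<notin> range axis_point"
            by blast
          with less.prems(4) \<open>J = UNIV\<close> have "P \<subseteq> {0}"
            by (fastforce simp: vec_eq_iff)
          moreover obtain v where "v \<noteq> 0" "P = vec.span {v}"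
            using P less.prems(1) pg_pointsE by blast
          ultimately show False
            using vec.span_base[of v "{v}"] by auto
        qed
        with \<sigma> axis_points_not_saturating[of S \<sigma>] assms(4) show False
          by auto
      qed
      then obtain i where i: "i \<notin> J"
        by blast
      have "card (- insert i J) < card (- J)"
        using i by (intro psubset_card_mono) auto
      moreover have "\<forall>P\<in>pg_points. saturated_point \<rho> (split_off i S) P"
        using \<sigma> saturated_point_split_off saturated_point_mono Suc_leI by metis
      moreover have "\<forall>l\<in>insert i J. \<forall>P\<in>split_off i S. P = axis_point l \<or> P \<subseteq> {v. v $ l = 0}"
      proof (intro ballI)
        fix l P assume l: "l \<in> insert i J" and P: "P \<in> split_off i S"
        consider "P = axis_point i" | Q where "Q \<in> S" "P = drop_coord i ` Q"
          using P by (auto simp: split_off_def)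
        then show "P = axis_point l \<or> P \<subseteq> {v. v $ l = 0}"
        proof cases
          case 1
          then show ?thesis
            by (cases "l = i") (auto simp: axis_point_def vec.span_singleton axis_def)
        next
          case 2
          show ?thesis
          proof (cases "l = i")
            case True
            with 2 show ?thesis
              by (auto simp: drop_coord_def)
          next
            case False
            with l 2 less.prems(4) have "Q = axis_point l \<or> Q \<subseteq> {v. v $ l = 0}"
              by blast
            then show ?thesis
            proof
              assume "Q = axis_point l"
              with False 2 show ?thesis
                by (simp add: drop_coord_image_axis_point)
            next
              assume "Q \<subseteq> {v. v $ l = 0}"
              with False 2 show ?thesis
                by (auto simp: drop_coord_def)
            qed
          qed
        qed
      qed
      ultimately have "\<exists>S' :: ('a ^ 'n) set set. saturating_set \<rho> S' \<and> card S' \<le> card (split_off i S)"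
        using less.hyps split_off_subset_pg_points axis_points_subset_split_off less.prems(1,2)
        by metis
      then show ?thesis
        using card_split_off_le[OF less.prems(2)] order.trans by blast
    qed auto
  qed
  from this[of S "{}"] assms show ?thesis
    by blast
qed

section \<open>From explicit vectors to saturation and size bounds\<close>

lemma min_saturating_size_le:
  assumes "saturating_set \<rho> (S :: ('a::{field,finite} ^ 'n::finite) set set)"
  shows "min_saturating_size TYPE('a ^ 'n) \<rho> \<le> card S"
proof -
  have "finite {card S |S :: ('a ^ 'n) set set. saturating_set \<rho> S}"
    by (rule finite_subset[of _ "range card"]) auto
  with assms show ?thesis
    unfolding min_saturating_size_def by (intro Min_le) auto
qed

lemma saturated_point_of_sum:
  fixes w :: "nat \<Rightarrow> 'a::field ^ 'n::finite"
  assumes "\<And>i. i < k \<Longrightarrow> w i \<in> insert 0 A" and "v = (\<Sum>i<k. g i *s w i)" and "k = \<rho> + 1"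
  shows "saturated_point \<rho> ((\<lambda>w. vec.span {w}) ` A) (vec.span {v})"
proof -
  define T where "T = (\<lambda>w. vec.span {w}) ` (w ` {..<k} - {0})"
  have "T \<subseteq> (\<lambda>w. vec.span {w}) ` A"
    using assms(1) by (auto simp: T_def)
  moreover have "w i \<in> pg_span T" if "i < k" for i
  proof (cases "w i = 0")
    case False
    with that have "w i \<in> \<Union>T"
      by (auto simp: T_def intro: vec.span_base)
    then show ?thesis
      by (simp add: pg_span_def vec.span_base)
  qed (simp add: pg_span_def vec.span_zero)
  then have "v \<in> pg_span T"
    unfolding assms(2) pg_span_def by (intro vec.span_sum vec.span_scale) auto
  then have "vec.span {v} \<subseteq> pg_span T"
    unfolding pg_span_def by (intro vec.span_minimal) auto
  moreover have "vec.dim (pg_span T) \<le> \<rho> + 1"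
  proof -
    have "\<Union>T \<subseteq> vec.span (w ` {..<k})"
      unfolding T_def by (intro UN_least vec.span_mono) auto
    then have "pg_span T \<subseteq> vec.span (w ` {..<k})"
      unfolding pg_span_def by (intro vec.span_minimal) auto
    then have "vec.dim (pg_span T) \<le> card (w ` {..<k})"
      by (intro vec.dim_le_card) auto
    also have "\<dots> \<le> k"
      using card_image_le[of "{..<k}" w] by simp
    finally show ?thesis
      using assms(3) by simp
  qed
  ultimately show ?thesis
    unfolding saturated_point_def by blast
qed

section \<open>The construction\<close>

context finite_subfield
begin

definition subvectors :: "'n::finite set \<Rightarrow> ('a ^ 'n) set" where
  "subvectors H = {u. (\<forall>i\<in>H. u $ i = 0) \<and> (\<forall>i. u $ i \<in> K)}"

lemma card_subvectors_le: "card (subvectors (H :: 'n::finite set)) \<le> card K ^ (CARD('n) - card H)"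
proof -
  have "subvectors H \<subseteq> (\<lambda>f. \<chi> j. if j \<in> H then 0 else f j) ` ((- H) \<rightarrow>\<^sub>E K)"
  proof
    fix u :: "'a ^ 'n" assume "u \<in> subvectors H"
    then show "u \<in> (\<lambda>f. \<chi> j. if j \<in> H then 0 else f j) ` ((- H) \<rightarrow>\<^sub>E K)"
      by (intro image_eqI[of _ _ "restrict (($) u) (- H)"]) (auto simp: subvectors_def vec_eq_iff)
  qed
  then have "card (subvectors H) \<le> card ((- H) \<rightarrow>\<^sub>E K)"
    by (intro surj_card_le) (auto intro: finite_PiE)
  also have "\<dots> = card K ^ (CARD('n) - card H)"
    by (simp add: card_PiE Compl_eq_Diff_UNIV card_Diff_subset)
  finally show ?thesis .
qed

text \<open>The nonzero \<open>K\<close>-multiples of a vector give the same point, so each point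
  arises from at least \<open>card K - 1\<close> nonzero vectors. The product form avoids a
  division.\<close>

lemma card_subvector_points_le:
  "card ((\<lambda>u. vec.span {u}) ` (subvectors H - {0})) * (card K - 1) \<le> card (subvectors H) - 1"
proof -
  let ?U = "subvectors H - {0}" and ?f = "\<lambda>u :: 'a ^ 'b. vec.span {u}"
  have fibre: "card K - 1 \<le> card {x \<in> ?U. ?f x = p}" if "p \<in> ?f ` ?U" for p
  proof -
    obtain u where u: "u \<in> ?U" "p = ?f u"
      using \<open>p \<in> ?f ` ?U\<close> by blast
    have "(\<lambda>a. a *s u) ` (K - {0}) \<subseteq> {x \<in> ?U. ?f x = p}"
    proof clarify
      fix a assume a: "a \<in> K" "a \<noteq> 0"
      have "a *s u \<in> ?U"
        using u a by (auto simp: subvectors_def mult_mem)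
      moreover have "?f (a *s u) = ?f u"
        using vec.span_image_scale[of "{u}" "\<lambda>_. a"] a by simp
      ultimately show "a *s u \<in> ?U \<and> ?f (a *s u) = p"
        using u by simp
    qed
    moreover have "inj_on (\<lambda>a. a *s u) (K - {0})"
      using u by (auto simp: inj_on_def)
    ultimately have "card (K - {0}) \<le> card {x \<in> ?U. ?f x = p}"
      by (intro card_inj_on_le) auto
    then show ?thesis
      using zero_mem by (simp add: card_Diff_singleton)
  qed
  have "card (?f ` ?U) * (card K - 1) = (\<Sum>p\<in>?f ` ?U. card K - 1)"
    by simp
  also have "\<dots> \<le> (\<Sum>p\<in>?f ` ?U. card {x \<in> ?U. ?f x = p})"
    by (intro sum_mono fibre)
  also have "\<dots> = card ?U"
    using sum.image_gen[of ?U "\<lambda>_. 1::nat" ?f] by simp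
  also have "\<dots> = card (subvectors H) - 1"
    using zero_mem by (intro card_Diff_singleton) (auto simp: subvectors_def)
  finally show ?thesis .
qed

text \<open>\<open>h\<close> lists the \<open>k\<close> coordinates of the first block. Indices
  start at 0, so coordinate \<open>h i\<close> comes with \<open>i + 1\<close> multipliers, and
  there are 1 + ... + k pairs in all.\<close>

definition generators :: "(nat \<Rightarrow> 'n::finite) \<Rightarrow> (nat \<Rightarrow> 'a) \<Rightarrow> nat \<Rightarrow> ('a ^ 'n) set" where
  "generators h b k =
     (\<lambda>((i, j), u). axis (h i) 1 + b j *s u) ` ((SIGMA i:{..<k}. {..i}) \<times> subvectors (h ` {..<k}))"

lemma card_generators_le:
  "card (generators h b k) \<le> (k * (k + 1) div 2) * card (subvectors (h ` {..<k}))"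
proof -
  have "card (SIGMA i:{..<k}. {..i}) = (\<Sum>i<k. Suc i)"
    by simp
  also have "\<dots> = k * (k + 1) div 2"
    by (induction k) auto
  finally have "card (SIGMA i:{..<k}. {..i}) = k * (k + 1) div 2" .
  then have "card ((SIGMA i:{..<k}. {..i}) \<times> subvectors (h ` {..<k})) =
      (k * (k + 1) div 2) * card (subvectors (h ` {..<k}))"
    by (simp only: card_cartesian_product)
  moreover have "finite ((SIGMA i:{..<k}. {..i}) \<times> subvectors (h ` {..<k}))"
    by (intro finite_cartesian_product finite_SigmaI) auto
  ultimately show ?thesis
    unfolding generators_def using card_image_le by metis
qed

lemma generators_nonzero:
  assumes "w \<in> generators h b k"
  shows "w \<noteq> 0"
proof -
  obtain i j u where "i < k" "u \<in> subvectors (h ` {..<k})" "w = axis (h i) 1 + b j *s u"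
    using assms by (auto simp: generators_def)
  then have "w $ h i = 1"
    by (simp add: subvectors_def axis_def)
  then show ?thesis
    by auto
qed

lemma axis_in_generators:
  "i < k \<Longrightarrow> axis (h i) 1 \<in> generators h b k"
  unfolding generators_def using zero_mem
  by (intro image_eqI[of _ _ "((i, 0), 0)"]) (auto simp: subvectors_def)

lemma axis_in_subvectors: "i \<notin> H \<Longrightarrow> axis i 1 \<in> subvectors H"
  using zero_mem one_mem by (auto simp: subvectors_def axis_def)

lemma sum_of_generators:
  fixes h :: "nat \<Rightarrow> 'n::finite" and v :: "'a ^ 'n"
  assumes "CARD('a) = card K ^ k" and "indep b k" and "inj_on h {..<k}"
  obtains g w where "v = (\<Sum>i<k. g i *s w i)"
    and "\<And>i. i < k \<Longrightarrow> w i \<in> generators h b k \<union> subvectors (h ` {..<k})"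
proof -
  let ?H = "h ` {..<k}"
  define Q where "Q i x \<longleftrightarrow> (v $ h i \<noteq> 0 \<longrightarrow> (\<exists>j\<le>i. x = v $ h i * b j))" for i x
  have "\<exists>x. Q i x \<and> x \<notin> comb c i" if "i < k" "indep c i" for i c
  proof -
    have b: "indep b (Suc i)"
      using assms(2) that(1) by (simp add: indep_def)
    show ?thesis
      \<comment> \<open>The first instance serves a nonzero coordinate; the second, with factor 1,
        supplies an arbitrary element outside the span when the coordinate is zero.\<close>
      using exists_multiple_notin_comb[OF b that(2), of "v $ h i"]
        exists_multiple_notin_comb[OF b that(2), of 1] by (auto simp: Q_def)
  qed
  from indep_greedy[OF this] obtain c where c: "indep c k" "\<And>i. i < k \<Longrightarrow> Q i (c i)"
    by blast
  \<comment> \<open>The span of \<open>c\<close> has \<open>card K ^ k\<close> elements, as many as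
    the field.\<close>
  have "comb c k = UNIV"
    using card_comb[OF c(1)] assms(1) by (intro card_subset_eq) auto
  then have "\<exists>a. (\<forall>i. a i \<in> K) \<and> v $ r = (\<Sum>i<k. a i * c i)" for r
    by (auto simp: comb_def set_eq_iff)
  then obtain a where a: "\<And>r i. a r i \<in> K" "\<And>r. v $ r = (\<Sum>i<k. a r i * c i)"
    by metis
  from c(2) obtain J where J: "\<And>i. i < k \<Longrightarrow> v $ h i \<noteq> 0 \<Longrightarrow> J i \<le> i \<and> c i = v $ h i * b (J i)"
    unfolding Q_def by metis
  define u where "u i = (\<chi> r. if r \<in> ?H then 0 else a r i)" for i
  define w where "w i = (if v $ h i = 0 then u i else axis (h i) 1 + b (J i) *s u i)" for i
  define g where "g i = (if v $ h i = 0 then c i else v $ h i)" for i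
  have u: "u i \<in> subvectors ?H" for i
    using a zero_mem by (auto simp: u_def subvectors_def)
  \<comment> \<open>In both cases the factors are chosen so that outside the first block
    \<open>g i *s w i\<close> is \<open>c i\<close> times \<open>u i\<close>; inside it, only
    coordinate \<open>h i\<close> can be nonzero.\<close>
  have gw: "(g i *s w i) $ r = (if r = h i then v $ r else c i * u i $ r)" if "i < k" for i r
    using that J[OF that] by (auto simp: g_def w_def axis_def u_def)
  have "v $ r = (\<Sum>i<k. g i *s w i) $ r" for r
  proof (cases "r \<in> ?H")
    case True
    then obtain l where l: "l < k" "r = h l"
      by blast
    have "(\<Sum>i<k. (g i *s w i) $ r) = (\<Sum>i<k. if i = l then v $ r else 0)"
      using l assms(3) by (intro sum.cong) (auto simp: gw u_def inj_on_def simp del: vector_smult_component)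
    then show ?thesis
      using l by (simp add: sum_component)
  next
    case False
    then have "(\<Sum>i<k. (g i *s w i) $ r) = (\<Sum>i<k. a r i * c i)"
      by (intro sum.cong) (auto simp: gw u_def simp del: vector_smult_component)
    then show ?thesis
      using a by (simp add: sum_component)
  qed
  then have "v = (\<Sum>i<k. g i *s w i)"
    by (simp add: vec_eq_iff)
  moreover have "w i \<in> generators h b k \<union> subvectors ?H" if "i < k" for i
  proof (cases "v $ h i = 0")
    case False
    with J[OF that] u that have "w i \<in> generators h b k"
      unfolding generators_def by (intro image_eqI[of _ _ "((i, J i), u i)"]) (auto simp: w_def)
    then show ?thesis
      by simp
  qed (simp add: w_def u)
  ultimately show ?thesis
    using that by blast
qed

text \<open>The generators give the triangular number times
  \<open>card K ^ (CARD('n) - (\<rho> + 1))\<close> as a bound, and \<open>t\<close> counts the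
  points over \<open>K\<close> in the second block. All coordinate points occur, so the parameter
  can be raised to exactly \<open>\<rho>\<close> at no cost in size.\<close>

lemma exists_small_saturating_set:
  assumes "CARD('a) = card K ^ (\<rho> + 1)" and "\<rho> + 1 < CARD('n::finite)"
  obtains S :: "('a ^ 'n) set set" and t where "saturating_set \<rho> S"
    and "card S \<le> ((\<rho> + 1) * (\<rho> + 2) div 2) * card K ^ (CARD('n) - (\<rho> + 1)) + t"
    and "t * (card K - 1) \<le> card K ^ (CARD('n) - (\<rho> + 1)) - 1"
proof -
  let ?k = "\<rho> + 1" and ?p = "\<lambda>w :: 'a ^ 'n. vec.span {w}"
  obtain h :: "nat \<Rightarrow> 'n" where "bij_betw h {0..<CARD('n)} UNIV"
    using ex_bij_betw_nat_finite[of "UNIV :: 'n set"] by auto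
  then have h: "inj_on h {..<?k}"
    using assms(2) by (auto simp: bij_betw_def inj_on_def)
  define H where "H = h ` {..<?k}"
  have card_H: "card H = ?k"
    using h by (simp add: H_def card_image)
  obtain b where b: "indep b ?k"
    using exists_indep[OF assms(1)] by blast
  define A where "A = generators h b ?k \<union> (subvectors H - {0})"
  define t where "t = card (?p ` (subvectors H - {0}))"
  have "?p ` A \<subseteq> pg_points"
    using generators_nonzero by (auto simp: A_def intro!: span_singleton_in_pg_points)
  moreover have "range axis_point \<subseteq> ?p ` A"
  proof clarify
    fix l
    have "axis l 1 \<in> A"
      unfolding A_def H_def
      using axis_in_generators[of _ ?k h b] axis_in_subvectors[of l "h ` {..<?k}"] axis_nonzero
      by (cases "l \<in> h ` {..<?k}") auto
    then show "axis_point l \<in> ?p ` A"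
      unfolding axis_point_def by blast
  qed
  moreover have "\<forall>P\<in>pg_points. saturated_point \<rho> (?p ` A) P"
  proof
    fix P :: "('a ^ 'n) set" assume "P \<in> pg_points"
    then obtain v where v: "P = ?p v"
      using pg_pointsE by blast
    obtain g w where "v = (\<Sum>i<?k. g i *s w i)"
      and "\<And>i. i < ?k \<Longrightarrow> w i \<in> generators h b ?k \<union> subvectors H"
      using sum_of_generators[OF assms(1) b h] H_def by blast
    then show "saturated_point \<rho> (?p ` A) P"
      unfolding v by (intro saturated_point_of_sum[of ?k w]) (auto simp: A_def)
  qed
  ultimately obtain S :: "('a ^ 'n) set set" where S: "saturating_set \<rho> S" "card S \<le> card (?p ` A)"
    using exists_saturating_set_card_le[of "?p ` A" \<rho>] assms(2) by auto
  have U: "card (subvectors H) \<le> card K ^ (CARD('n) - ?k)"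
    using card_subvectors_le[of H] card_H by simp
  have "card (?p ` A) \<le> card (?p ` generators h b ?k) + t"
    unfolding A_def t_def image_Un by (rule card_Un_le)
  also have "\<dots> \<le> card (generators h b ?k) + t"
    by (simp add: card_image_le)
  also have "\<dots> \<le> (?k * (?k + 1) div 2) * card (subvectors H) + t"
    using card_generators_le[of h b ?k] by (simp add: H_def)
  also have "\<dots> \<le> (?k * (?k + 1) div 2) * card K ^ (CARD('n) - ?k) + t"
    using U by (intro add_right_mono mult_left_mono) auto
  also have "?k + 1 = \<rho> + 2"
    by simp
  finally have "card S \<le> (?k * (\<rho> + 2) div 2) * card K ^ (CARD('n) - ?k) + t"
    using S by simp
  moreover have "t * (card K - 1) \<le> card K ^ (CARD('n) - ?k) - 1"
    using card_subvector_points_le[of H] U by (simp add: t_def)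
  ultimately show ?thesis
    using that S by blast
qed

end

theorem theorem7p13:
  fixes N \<rho> q q' :: nat
  assumes "1 < \<rho>" and "\<rho> < N"
    and "primepow q'" and "q = q' ^ (\<rho> + 1)"
    and "CARD('a::{field,finite}) = q" and "CARD('n::finite) = N + 1"
  shows "real (min_saturating_size TYPE('a ^ 'n) \<rho>) \<le>
    (real \<rho> + 1) * (real \<rho> + 2) / 2 * real q' ^ (N - \<rho>) +
    real \<rho> * (real \<rho> + 1) * ((real q' ^ (N - \<rho>) - 1) / (real q' - 1))"
proof -
  obtain K :: "'a set" where K: "finite_subfield K" "card K = q'"
    using finite_subfield_exists[of q' "\<rho> + 1"] assms by auto
  interpret finite_subfield K
    by (rule K)
  have "q' > 1"
    using assms(3) primepow_gt_Suc_0 by auto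
  obtain S :: "('a ^ 'n) set set" and t where S: "saturating_set \<rho> S"
    and card_S: "card S \<le> ((\<rho> + 1) * (\<rho> + 2) div 2) * q' ^ (N - \<rho>) + t"
    and t: "t * (q' - 1) \<le> q' ^ (N - \<rho>) - 1"
    using exists_small_saturating_set[of \<rho>, where 'n='n] K assms by auto
  have "real (min_saturating_size TYPE('a ^ 'n) \<rho>) \<le> real (card S)"
    using min_saturating_size_le[OF S] by simp
  also have "\<dots> \<le> real ((\<rho> + 1) * (\<rho> + 2) div 2) * real q' ^ (N - \<rho>) + real t"
    using card_S by (metis of_nat_add of_nat_le_iff of_nat_mult of_nat_power)
  \<comment> \<open>A product of consecutive integers is even, so the integer division is
    exact.\<close>
  also have "real ((\<rho> + 1) * (\<rho> + 2) div 2) = (real \<rho> + 1) * (real \<rho> + 2) / 2"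
    by (subst real_of_nat_div) (auto simp: algebra_simps)
  \<comment> \<open>The quotient alone bounds \<open>t\<close>; the factor
    \<open>\<rho> * (\<rho> + 1)\<close> is at least 1 and only enlarges the bound.\<close>
  also have "real t \<le> real \<rho> * (real \<rho> + 1) * ((real q' ^ (N - \<rho>) - 1) / (real q' - 1))"
  proof -
    have "real (t * (q' - 1)) \<le> real (q' ^ (N - \<rho>) - 1)"
      using t of_nat_le_iff by blast
    then have "real t \<le> (real q' ^ (N - \<rho>) - 1) / (real q' - 1)"
      using \<open>q' > 1\<close> by (simp add: field_simps of_nat_diff)
    moreover have "1 * 1 \<le> real \<rho> * (real \<rho> + 1)"
      using assms(1) by (intro mult_mono) auto
    ultimately show ?thesis
      using mult_mono[of 1 "real \<rho> * (real \<rho> + 1)" "real t"] by force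
  qed
  finally show ?thesis
    by simp
qed

end
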